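(* Let $n\ge 4$ and $2\le i\le\lfloor n/2\rfloor$. The subgroup $\mathbf{Z}_{C_i}$ of the $n\times n\times n$ Rubik's Cube group $\mathbf{G}$ consisting of the elements that fix every facelet outside the center corner orbit $i$ is isomorphic to the alternating group $\mathcal{A}_{24}$ (both for odd and for even $n$).
   Context: The $n\times n\times n$ Rubik's Cube has faces U, D, F, B, R, L, each an $n\times n$ grid of facelets carrying stickers ($6n^2$ in total). For $1\le k\le\lfloor n/2\rfloor$, $F_k,B_k,R_k,L_k,U_k,D_k$ denote clockwise (seen from the named face) $90^\circ$ rotations of the $k$-th $n\times n\times 1$ slice counted from the named face. $\mathbf{G}$ is the subgroup of the symmetric group on the facelets generated by the facelet permutations induced by these moves. On each face index facelets by $(r,c)$, $1\le r,c\le n$. For $2\le i\le\lfloor n/2\rfloor$, the center corner orbit $i$ is the set of 24 facelets $(r,c)$ with $r,c\in\{i,n+1-i\}$ on the six faces (these belong to one-sticker center cubies); $\mathbf{Z}_{C_i}$ acts on it by permutations. *)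

theory Defs
  imports "HOL-Algebra.Sym_Groups" "HOL-Algebra.Generated_Groups"
begin

datatype face = Up | Down | Front | Back | Right | Left

text \<open>
  A facelet is a face together with its row and column. Every face is seen from outside the cube
  and laid out in the net
  \<^verbatim>\<open>
        Up
   Left Front Right Back
        Down
  \<close>
  with row 1 at the top and column 1 at the left of each face of the net.
\<close>

type_synonym facelet = "face \<times> nat \<times> nat"

definition facelets :: "nat \<Rightarrow> facelet set" where
  "facelets n = UNIV \<times> {1..n} \<times> {1..n}"

text \<open>
  Effect of a clockwise quarter turn of the \<open>k\<close>-th slice counted from the first given face on the
  facelets of the four adjacent faces.
\<close>

fun side_turn :: "nat \<Rightarrow> face \<Rightarrow> nat \<Rightarrow> facelet \<Rightarrow> facelet" where
  "side_turn n Front k (Up, r, c)    = (if r = n + 1 - k then (Right, c, k) else (Up, r, c))"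
| "side_turn n Front k (Right, r, c) = (if c = k then (Down, k, n + 1 - r) else (Right, r, c))"
| "side_turn n Front k (Down, r, c)  = (if r = k then (Left, c, n + 1 - k) else (Down, r, c))"
| "side_turn n Front k (Left, r, c)  = (if c = n + 1 - k then (Up, n + 1 - k, n + 1 - r) else (Left, r, c))"

| "side_turn n Back k (Up, r, c)     = (if r = k then (Left, n + 1 - c, k) else (Up, r, c))"
| "side_turn n Back k (Left, r, c)   = (if c = k then (Down, n + 1 - k, r) else (Left, r, c))"
| "side_turn n Back k (Down, r, c)   = (if r = n + 1 - k then (Right, n + 1 - c, n + 1 - k) else (Down, r, c))"
| "side_turn n Back k (Right, r, c)  = (if c = n + 1 - k then (Up, k, r) else (Right, r, c))"

| "side_turn n Right k (Front, r, c) = (if c = n + 1 - k then (Up, r, n + 1 - k) else (Front, r, c))"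
| "side_turn n Right k (Up, r, c)    = (if c = n + 1 - k then (Back, n + 1 - r, k) else (Up, r, c))"
| "side_turn n Right k (Back, r, c)  = (if c = k then (Down, n + 1 - r, n + 1 - k) else (Back, r, c))"
| "side_turn n Right k (Down, r, c)  = (if c = n + 1 - k then (Front, r, n + 1 - k) else (Down, r, c))"

| "side_turn n Left k (Front, r, c)  = (if c = k then (Down, r, k) else (Front, r, c))"
| "side_turn n Left k (Down, r, c)   = (if c = k then (Back, n + 1 - r, n + 1 - k) else (Down, r, c))"
| "side_turn n Left k (Back, r, c)   = (if c = n + 1 - k then (Up, n + 1 - r, k) else (Back, r, c))"
| "side_turn n Left k (Up, r, c)     = (if c = k then (Front, r, k) else (Up, r, c))"

| "side_turn n Up k (Front, r, c)    = (if r = k then (Left, k, c) else (Front, r, c))"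
| "side_turn n Up k (Left, r, c)     = (if r = k then (Back, k, c) else (Left, r, c))"
| "side_turn n Up k (Back, r, c)     = (if r = k then (Right, k, c) else (Back, r, c))"
| "side_turn n Up k (Right, r, c)    = (if r = k then (Front, k, c) else (Right, r, c))"

| "side_turn n Down k (Front, r, c)  = (if r = n + 1 - k then (Right, n + 1 - k, c) else (Front, r, c))"
| "side_turn n Down k (Right, r, c)  = (if r = n + 1 - k then (Back, n + 1 - k, c) else (Right, r, c))"
| "side_turn n Down k (Back, r, c)   = (if r = n + 1 - k then (Left, n + 1 - k, c) else (Back, r, c))"
| "side_turn n Down k (Left, r, c)   = (if r = n + 1 - k then (Front, n + 1 - k, c) else (Left, r, c))"

| "side_turn n _ k x = x"

text \<open>
  The first slice carries the whole named face with it. Slices with \<open>k \<le> n div 2\<close> never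
  contain the opposite face. Outside \<open>facelets n\<close> the map is the identity.
\<close>

definition turn :: "nat \<Rightarrow> face \<Rightarrow> nat \<Rightarrow> facelet \<Rightarrow> facelet" where
  "turn n X k x =
    (if x \<in> facelets n
     then (case x of (Y, r, c) \<Rightarrow>
             if Y = X then (if k = 1 then (X, c, n + 1 - r) else x) else side_turn n X k x)
     else x)"

definition facelet_sym_group :: "nat \<Rightarrow> (facelet \<Rightarrow> facelet) monoid" where
  "facelet_sym_group n = \<lparr> carrier = {p. p permutes facelets n}, mult = (\<circ>), one = id \<rparr>"

definition moves :: "nat \<Rightarrow> (facelet \<Rightarrow> facelet) set" where
  "moves n = {turn n X k | X k. 1 \<le> k \<and> k \<le> n div 2}"

definition rubik_group :: "nat \<Rightarrow> (facelet \<Rightarrow> facelet) monoid" where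
  "rubik_group n = (facelet_sym_group n) \<lparr> carrier := generate (facelet_sym_group n) (moves n) \<rparr>"

definition center_corner_orbit :: "nat \<Rightarrow> nat \<Rightarrow> facelet set" where
  "center_corner_orbit n i = UNIV \<times> {i, n + 1 - i} \<times> {i, n + 1 - i}"

definition Z_center_corner :: "nat \<Rightarrow> nat \<Rightarrow> (facelet \<Rightarrow> facelet) set" where
  "Z_center_corner n i =
    {g \<in> carrier (rubik_group n). \<forall>x \<in> facelets n - center_corner_orbit n i. g x = x}"

text \<open>
  The remaining facts check the definitions against the geometry of the cube \<open>[-n, n]\<^sup>3\<close>, whose
  cubies have side length 2; the axes point to \<open>Right\<close>, \<open>Up\<close> and \<open>Front\<close>, and \<open>position\<close> gives
  the midpoint of a facelet.
\<close>

fun position :: "nat \<Rightarrow> facelet \<Rightarrow> int \<times> int \<times> int" where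
  "position n (Front, r, c) = (2 * int c - int n - 1, int n + 1 - 2 * int r, int n)"
| "position n (Back, r, c)  = (int n + 1 - 2 * int c, int n + 1 - 2 * int r, - int n)"
| "position n (Right, r, c) = (int n, int n + 1 - 2 * int r, int n + 1 - 2 * int c)"
| "position n (Left, r, c)  = (- int n, int n + 1 - 2 * int r, 2 * int c - int n - 1)"
| "position n (Up, r, c)    = (2 * int c - int n - 1, int n, 2 * int r - int n - 1)"
| "position n (Down, r, c)  = (2 * int c - int n - 1, - int n, int n + 1 - 2 * int r)"

fun height :: "face \<Rightarrow> int \<times> int \<times> int \<Rightarrow> int" where
  "height Front (x, y, z) = z"
| "height Back (x, y, z)  = - z"
| "height Right (x, y, z) = x"
| "height Left (x, y, z)  = - x"
| "height Up (x, y, z)    = y"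
| "height Down (x, y, z)  = - y"

fun rotate_cw :: "face \<Rightarrow> int \<times> int \<times> int \<Rightarrow> int \<times> int \<times> int" where
  "rotate_cw Front (x, y, z) = (y, - x, z)"
| "rotate_cw Back (x, y, z)  = (- y, x, z)"
| "rotate_cw Right (x, y, z) = (x, z, - y)"
| "rotate_cw Left (x, y, z)  = (x, - z, y)"
| "rotate_cw Up (x, y, z)    = (- z, y, x)"
| "rotate_cw Down (x, y, z)  = (z, y, - x)"

definition in_slice :: "nat \<Rightarrow> face \<Rightarrow> nat \<Rightarrow> int \<times> int \<times> int \<Rightarrow> bool" where
  "in_slice n X k p \<longleftrightarrow> height X p \<in> {int n - 2 * int k .. int n - 2 * int k + 2}"

lemma inj_on_position: "inj_on (position n) (facelets n)"
proof (rule inj_onI)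
  fix x y
  assume xy: "x \<in> facelets n" "y \<in> facelets n" "position n x = position n y"
  obtain X r c Y r' c' where "x = (X, r, c)" "y = (Y, r', c')"
    by (metis prod_cases3)
  with xy show "x = y"
    by (cases X; cases Y) (auto simp: facelets_def)
qed

lemma turn_in_facelets:
  assumes "1 \<le> k" "k \<le> n div 2" "x \<in> facelets n"
  shows "turn n X k x \<in> facelets n"
proof -
  obtain Y r c where "x = (Y, r, c)" by (metis prod_cases3)
  with assms show ?thesis
    by (cases X; cases Y) (auto simp: turn_def facelets_def)
qed

lemma position_turn:
  assumes "1 \<le> k" "k \<le> n div 2" "x \<in> facelets n"
  shows "position n (turn n X k x) =
    (if in_slice n X k (position n x) then rotate_cw X (position n x) else position n x)"
proof -
  obtain Y r c where "x = (Y, r, c)" by (metis prod_cases3)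
  with assms show ?thesis
    by (cases X; cases Y) (auto simp: turn_def facelets_def in_slice_def)
qed

lemma inj_rotate_cw: "rotate_cw X p = rotate_cw X q \<Longrightarrow> p = q"
  by (cases p; cases q; cases X) auto

lemma in_slice_rotate_cw [simp]: "in_slice n X k (rotate_cw X p) = in_slice n X k p"
  by (cases p; cases X) (auto simp: in_slice_def)

lemma turn_permutes:
  assumes "1 \<le> k" "k \<le> n div 2"
  shows "turn n X k permutes facelets n"
proof (rule bij_imp_permutes)
  have "inj_on (turn n X k) (facelets n)"
  proof (rule inj_onI)
    fix x y
    assume xy: "x \<in> facelets n" "y \<in> facelets n" "turn n X k x = turn n X k y"
    then have "position n (turn n X k x) = position n (turn n X k y)" by simp
    then have "position n x = position n y"
      using position_turn[OF assms xy(1)] position_turn[OF assms xy(2)]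
      by (metis in_slice_rotate_cw inj_rotate_cw)
    then show "x = y" using xy inj_on_position by (auto dest: inj_onD)
  qed
  moreover have "turn n X k ` facelets n \<subseteq> facelets n"
    using turn_in_facelets[OF assms] by auto
  moreover have "finite (facelets n)"
  proof -
    have "(UNIV :: face set) = {Up, Down, Front, Back, Right, Left}"
      using face.exhaust by auto
    then have "finite (UNIV :: face set)" by (metis finite.simps)
    then show ?thesis by (simp add: facelets_def)
  qed
  ultimately show "bij_betw (turn n X k) (facelets n) (facelets n)"
    by (simp add: bij_betw_def endo_inj_surj)
qed (simp add: turn_def)

lemma facelet_sym_group_is_group: "group (facelet_sym_group n)"
  by (rule groupI)
    (auto simp: facelet_sym_group_def permutes_compose permutes_id comp_assoc
      intro: permutes_inv permutes_inv_o(2))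

lemma subgroup_rubik_group: "subgroup (carrier (rubik_group n)) (facelet_sym_group n)"
proof -
  have "moves n \<subseteq> carrier (facelet_sym_group n)"
    by (auto simp: moves_def facelet_sym_group_def turn_permutes)
  then show ?thesis
    by (simp add: rubik_group_def group.generate_is_subgroup[OF facelet_sym_group_is_group])
qed

lemma rubik_group_is_group: "group (rubik_group n)"
  using subgroup.subgroup_is_group[OF subgroup_rubik_group facelet_sym_group_is_group]
  by (simp add: rubik_group_def)

lemma subgroup_Z_center_corner: "subgroup (Z_center_corner n i) (rubik_group n)"
proof -
  interpret G: group "rubik_group n" by (rule rubik_group_is_group)
  have mult: "mult (rubik_group n) = (\<circ>)" and one: "one (rubik_group n) = id"
    by (simp_all add: rubik_group_def facelet_sym_group_def)
  show ?thesis
  proof (rule G.subgroupI)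
    show "Z_center_corner n i \<noteq> {}"
      using G.one_closed by (auto simp: Z_center_corner_def one)
  next
    fix g assume g: "g \<in> Z_center_corner n i"
    then have gG: "g \<in> carrier (rubik_group n)" by (simp add: Z_center_corner_def)
    then have "inv\<^bsub>rubik_group n\<^esub> g \<circ> g = id"
      using G.l_inv by (simp add: mult one)
    then have "(inv\<^bsub>rubik_group n\<^esub> g) (g x) = x" for x
      by (metis comp_apply id_apply)
    with g gG show "inv\<^bsub>rubik_group n\<^esub> g \<in> Z_center_corner n i"
      unfolding Z_center_corner_def by simp (metis DiffI)
  next
    fix g h assume "g \<in> Z_center_corner n i" "h \<in> Z_center_corner n i"
    then show "g \<otimes>\<^bsub>rubik_group n\<^esub> h \<in> Z_center_corner n i"
      using G.m_closed[of g h] by (auto simp: Z_center_corner_def mult)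
  qed (auto simp: Z_center_corner_def)
qed

end

theory Submission
  imports Defs
begin

text \<open>
  Let \<open>O\<^sub>m\<close> be the center corner orbit \<open>m\<close>; \<open>O\<^sub>1\<close> consists of the 24 stickers of the corner cubies.
  Every move acts evenly on \<open>O\<^sub>i \<union> O\<^sub>1\<close>: a turn of an outer slice acts on it by four 4-cycles, a turn
  of the \<open>i\<close>-th slice by two, and any other turn trivially. So an element supported on \<open>O\<^sub>i\<close> is even.

  Conversely, \<open>R\<^sub>i D\<^sub>i R\<^sub>i\<inverse>\<close> and \<open>U\<^sub>1\<close> move exactly one common facelet, so their commutator is a
  3-cycle, and it is supported on \<open>O\<^sub>i\<close>. Lying in a common 3-cycle of \<open>Z\<close> is an equivalence relation
  on \<open>O\<^sub>i\<close> (two 3-cycles that overlap generate the alternating group on their union), and it is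
  invariant under all moves because \<open>Z\<close> is normal in the cube group. Chasing facelets around the cube
  shows that there is a single class, which forces all 3-cycles on \<open>O\<^sub>i\<close> into \<open>Z\<close>.
\<close>

section \<open>Cycles of permutations\<close>

lemma cycle3_apply:
  assumes "distinct [a, b, c]"
  shows "cycle_of_list [a, b, c] x = (if x = a then b else if x = b then c else if x = c then a else x)"
  using assms by (auto simp: transpose_def)

lemma cycle3_square:
  assumes "distinct [a, b, c]"
  shows "cycle_of_list [a, b, c] \<circ> cycle_of_list [a, b, c] = cycle_of_list [a, c, b]"
proof -
  have "distinct [a, c, b]" using assms by auto
  with assms show ?thesis
    by (auto simp add: fun_eq_iff cycle3_apply simp del: cycle_of_list.simps)
qed

lemma inv_cycle3:
  assumes "distinct [a, b, c]"
  shows "inv' (cycle_of_list [a, b, c]) = cycle_of_list [a, c, b]"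
proof -
  have "distinct [a, c, b]" using assms by auto
  with assms show ?thesis
    by (intro inv_unique_comp)
      (auto simp add: fun_eq_iff cycle3_apply simp del: cycle_of_list.simps)
qed

lemma cycle3_rotate:
  assumes "distinct [a, b, c]"
  shows "cycle_of_list [b, c, a] = cycle_of_list [a, b, c]"
  using cycle_of_list_rotate_independent[OF assms, of 1] by simp

text \<open>The point \<open>f p\<close> is moved by \<open>f\<close> and differs from
  \<open>p\<close>, so \<open>g\<close> fixes it; likewise \<open>f\<close> fixes
  \<open>g p\<close>. Hence \<open>f\<close> and \<open>g\<close> commute at every \<open>x\<close>
  other than \<open>p\<close> and its preimages under \<open>f\<close> and \<open>g\<close>, and the
  commutator only has to account for these three points.\<close>

lemma commutator_eq_cycle3:
  assumes "bij f" "bij g"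
    and meet: "\<And>x. f x \<noteq> x \<Longrightarrow> g x \<noteq> x \<Longrightarrow> x = p"
    and p: "f p \<noteq> p" "g p \<noteq> p"
  shows "distinct [p, f p, g p]"
    and "f \<circ> g \<circ> inv' f \<circ> inv' g = cycle_of_list [p, f p, g p]"
proof -
  have injs: "f x = f y \<longleftrightarrow> x = y" "g x = g y \<longleftrightarrow> x = y" for x y
    using assms(1,2) by (auto dest: bij_is_inj simp: inj_eq)
  have gf: "g (f p) = f p" and fg: "f (g p) = g p"
    using meet[of "f p"] meet[of "g p"] p injs by blast+
  then show d: "distinct [p, f p, g p]"
    using p injs by auto
  \<comment> \<open>The identity is checked in the form "\<open>f\<close> after \<open>g\<close> is
    the cycle after \<open>g\<close> after \<open>f\<close>", which contains no inverses.\<close>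
  have "(f \<circ> g) x = (cycle_of_list [p, f p, g p] \<circ> (g \<circ> f)) x" for x
  proof (cases "x = p \<or> f x = p \<or> g x = p")
    case True
    then consider "x = p" | "x \<noteq> p" "f x = p" | "x \<noteq> p" "f x \<noteq> p" "g x = p" by blast
    then show ?thesis
    proof cases
      case 1
      then show ?thesis
        using d gf fg p injs unfolding comp_apply by (auto simp add: cycle3_apply simp del: cycle_of_list.simps)
    next
      case 2
      then have "g x = x" using meet[of x] by metis
      with 2 show ?thesis
        using d gf fg p injs unfolding comp_apply by (auto simp add: cycle3_apply simp del: cycle_of_list.simps)
    next
      case 3
      then have "f x = x" using meet[of x] by metis
      with 3 show ?thesis
        using d gf fg p injs unfolding comp_apply by (auto simp add: cycle3_apply simp del: cycle_of_list.simps)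
    qed
  next
    case False
    have "f (g x) = g (f x)"
    proof (cases "f x = x")
      case True
      have "f (g x) = g x"
        using True False meet[of "g x"] injs by metis
      then show ?thesis using True by simp
    next
      case nf: False
      then have "g x = x" using meet[of x] False by blast
      moreover have "g (f x) = f x" using nf False meet[of "f x"] injs by metis
      ultimately show ?thesis by simp
    qed
    moreover have "g (f x) \<noteq> p" "g (f x) \<noteq> f p" "g (f x) \<noteq> g p"
      using False calculation gf fg injs meet[of x] meet[of "f x"] meet[of "g x"] by metis+
    ultimately show ?thesis
      using d unfolding comp_apply by (auto simp add: cycle3_apply simp del: cycle_of_list.simps)
  qed
  then have eq: "f \<circ> g = cycle_of_list [p, f p, g p] \<circ> (g \<circ> f)" by blast
  show "f \<circ> g \<circ> inv' f \<circ> inv' g = cycle_of_list [p, f p, g p]"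
    unfolding eq using assms(1,2)
    by (simp add: fun_eq_iff bij_is_surj surj_f_inv_f del: cycle_of_list.simps)
qed

section \<open>Points linked by a common 3-cycle\<close>

definition in_common_cycle3 :: "('a \<Rightarrow> 'a) set \<Rightarrow> 'a \<Rightarrow> 'a \<Rightarrow> bool" where
  "in_common_cycle3 Z a b \<longleftrightarrow>
    a = b \<or> (\<exists>c. distinct [a, b, c] \<and> cycle_of_list [a, b, c] \<in> Z)"

locale comp_closed =
  fixes Z :: "('a \<Rightarrow> 'a) set"
  assumes comp_closed: "p \<in> Z \<Longrightarrow> q \<in> Z \<Longrightarrow> p \<circ> q \<in> Z"
begin

text \<open>The inverse of a 3-cycle is its square, so closure under composition provides
  it.\<close>

lemma cycle3_inverse_in:
  "distinct [a, b, c] \<Longrightarrow> cycle_of_list [a, b, c] \<in> Z \<Longrightarrow> cycle_of_list [a, c, b] \<in> Z"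
  by (metis comp_closed cycle3_square)

lemma cycle3_conj_in:
  assumes "distinct [a, b, c]" "cycle_of_list [a, b, c] \<in> Z"
    and "distinct [x, y, z]" "cycle_of_list [x, y, z] \<in> Z"
  shows "cycle_of_list (map (cycle_of_list [x, y, z]) [a, b, c]) \<in> Z"
proof -
  have "bij (cycle_of_list [x, y, z])"
    using permutation_bijective[OF permutation_of_cycle] .
  then show ?thesis
    using conjugation_of_cycle[OF assms(1)] inv_cycle3[OF assms(3)] cycle3_inverse_in[OF assms(3,4)]
      assms comp_closed by metis
qed

lemma in_common_cycle3_sym:
  assumes "in_common_cycle3 Z a b"
  shows "in_common_cycle3 Z b a"
proof (cases "a = b")
  case False
  then obtain c where c: "distinct [a, b, c]" "cycle_of_list [a, b, c] \<in> Z"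
    using assms by (auto simp: in_common_cycle3_def simp del: cycle_of_list.simps)
  then have "cycle_of_list [b, a, c] \<in> Z" "distinct [b, a, c]"
    using cycle3_inverse_in[OF c] cycle3_rotate[of b a c] by auto
  then show ?thesis unfolding in_common_cycle3_def by blast
qed (simp add: in_common_cycle3_def)

text \<open>Take cycles \<open>[a, b, x]\<close> and \<open>[b, c, y]\<close>. If
  \<open>x = c\<close> or \<open>y = a\<close>, one of them already runs through \<open>a\<close>,
  \<open>b\<close> and \<open>c\<close>, and its inverse serves. Otherwise conjugating the first by
  the second fixes \<open>a\<close> and sends \<open>b\<close> to \<open>c\<close>.\<close>

lemma in_common_cycle3_trans:
  assumes "in_common_cycle3 Z a b" "in_common_cycle3 Z b c"
  shows "in_common_cycle3 Z a c"
proof (cases "a = b \<or> b = c \<or> a = c")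
  case True
  with assms show ?thesis by (auto simp: in_common_cycle3_def)
next
  case False
  then obtain x y where x: "distinct [a, b, x]" "cycle_of_list [a, b, x] \<in> Z"
    and y: "distinct [b, c, y]" "cycle_of_list [b, c, y] \<in> Z"
    using assms by (auto simp: in_common_cycle3_def simp del: cycle_of_list.simps)
  consider "x = c" | "y = a" | "x \<noteq> c" "y \<noteq> a" by blast
  then show ?thesis
  proof cases
    case 1
    have "distinct [a, c, b]" using False by auto
    then show ?thesis
      using cycle3_inverse_in[OF x] 1 unfolding in_common_cycle3_def by blast
  next
    case 2
    have "distinct [a, c, b]" "distinct [a, b, c]" using False by auto
    then show ?thesis
      using cycle3_inverse_in[of a b c] cycle3_rotate[of a b c] y 2
      unfolding in_common_cycle3_def by metis
  next
    case 3
    have "cycle_of_list (map (cycle_of_list [b, c, y]) [a, b, x]) \<in> Z"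
      by (rule cycle3_conj_in[OF x y])
    moreover have "map (cycle_of_list [b, c, y]) [a, b, x] = [a, c, if x = y then b else x]"
      using x(1) y(1) 3 False by (auto simp add: cycle3_apply simp del: cycle_of_list.simps)
    moreover have "distinct [a, c, if x = y then b else x]" using x(1) y(1) 3 False by auto
    ultimately show ?thesis unfolding in_common_cycle3_def by metis
  qed
qed

text \<open>Start from a cycle \<open>[a, b, x]\<close> and replace \<open>x\<close> by
  \<open>c\<close>: conjugation by a cycle \<open>[x, c, z]\<close> sends \<open>x\<close> to
  \<open>c\<close>. The assumption \<open>dom\<close> puts \<open>x\<close> into \<open>S\<close>,
  so that such a cycle exists.\<close>

lemma cycle3_in_if_connected:
  assumes conn: "\<And>a b. a \<in> S \<Longrightarrow> b \<in> S \<Longrightarrow> in_common_cycle3 Z a b"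
    and dom: "\<And>p x. p \<in> Z \<Longrightarrow> p x \<noteq> x \<Longrightarrow> x \<in> S"
    and abc: "distinct [a, b, c]" "a \<in> S" "b \<in> S" "c \<in> S"
  shows "cycle_of_list [a, b, c] \<in> Z"
proof -
  obtain x where x: "distinct [a, b, x]" "cycle_of_list [a, b, x] \<in> Z"
    using conn[of a b] abc by (auto simp: in_common_cycle3_def simp del: cycle_of_list.simps)
  show ?thesis
  proof (cases "x = c")
    case False
    have "cycle_of_list [a, b, x] x \<noteq> x"
      using x(1) by (auto simp: cycle3_apply simp del: cycle_of_list.simps)
    then have "x \<in> S" using dom x(2) by blast
    then obtain z where z: "distinct [x, c, z]" "cycle_of_list [x, c, z] \<in> Z"
      using conn[of x c] abc False by (auto simp: in_common_cycle3_def simp del: cycle_of_list.simps)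
    note zi = cycle3_inverse_in[OF z]
    have dz: "distinct [x, z, c]" using z(1) by auto
    have dac: "distinct [a, c, b]" using abc by auto
    \<comment> \<open>If \<open>z\<close> is \<open>a\<close> or \<open>b\<close>, conjugation by
      \<open>[x, c, z]\<close> would displace that point. Its inverse \<open>[x, z, c]\<close> is
      used instead; the conjugate is then the inverse of \<open>[a, b, c]\<close>.\<close>
    consider "z = a" | "z = b" | "z \<noteq> a" "z \<noteq> b" by blast
    then show ?thesis
    proof cases
      case 1
      have "map (cycle_of_list [x, z, c]) [a, b, x] = [c, b, a]"
        using x(1) z(1) 1 abc False dz by (auto simp add: cycle3_apply simp del: cycle_of_list.simps)
      then have "cycle_of_list [c, b, a] \<in> Z"
        using cycle3_conj_in[OF x dz zi] by metis
      then have "cycle_of_list [a, c, b] \<in> Z"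
        using cycle3_rotate[of a c b] dac by metis
      then show ?thesis using cycle3_inverse_in[OF dac] by blast
    next
      case 2
      have "map (cycle_of_list [x, z, c]) [a, b, x] = [a, c, b]"
        using x(1) z(1) 2 abc False dz by (auto simp add: cycle3_apply simp del: cycle_of_list.simps)
      then have "cycle_of_list [a, c, b] \<in> Z"
        using cycle3_conj_in[OF x dz zi] by metis
      then show ?thesis using cycle3_inverse_in[OF dac] by blast
    next
      case 3
      have "map (cycle_of_list [x, c, z]) [a, b, x] = [a, b, c]"
        using x(1) z(1) 3 abc False by (auto simp add: cycle3_apply simp del: cycle_of_list.simps)
      then show ?thesis
        using cycle3_conj_in[OF x z] by metis
    qed
  qed (use x in simp)
qed

end

text \<open>Conjugation relabels the entries of a cycle by \<open>g\<close>. Applied to moves, this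
  carries links between facelets around the cube.\<close>

lemma in_common_cycle3_conj:
  assumes "bij g" "\<And>p. p \<in> Z \<Longrightarrow> g \<circ> p \<circ> inv' g \<in> Z" "in_common_cycle3 Z a b"
  shows "in_common_cycle3 Z (g a) (g b)"
proof (cases "a = b")
  case False
  then obtain c where c: "distinct [a, b, c]" "cycle_of_list [a, b, c] \<in> Z"
    using assms by (auto simp: in_common_cycle3_def simp del: cycle_of_list.simps)
  then have "cycle_of_list [g a, g b, g c] \<in> Z"
    using conjugation_of_cycle[OF c(1) assms(1)] assms(2)[OF c(2)] by (simp del: cycle_of_list.simps)
  moreover have "distinct [g a, g b, g c]"
    using c(1) assms(1) by (auto simp: bij_def inj_eq)
  ultimately show ?thesis unfolding in_common_cycle3_def by blast
qed (simp add: in_common_cycle3_def)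

section \<open>Signs of products of 4-cycles\<close>

lemma sign_cycle4:
  "distinct [a, b, c, d] \<Longrightarrow> sign (cycle_of_list [a, b, c, d]) = - 1"
  by (simp add: sign_compose permutation_compose permutation_swap_id sign_swap_id)

text \<open>The condition \<open>map f cs = rotate1 cs\<close> makes each list a 4-cycle of
  \<open>f\<close>, which is odd. The induction splits off one cycle and continues with
  \<open>f\<close> on the rest of \<open>A\<close>.\<close>

lemma sign_on_cycles4:
  assumes "finite A" "bij_betw f A A" "distinct (concat css)" "set (concat css) \<subseteq> A"
    and "\<And>cs. cs \<in> set css \<Longrightarrow> length cs = 4 \<and> map f cs = rotate1 cs"
    and "\<And>x. x \<in> A - set (concat css) \<Longrightarrow> f x = x"
  shows "sign_on A f = (- 1) ^ length css"
  using assms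
proof (induction css arbitrary: A)
  case Nil
  then have "restrict_id f A = id" by (auto simp: restrict_id_def)
  then show ?case by (simp add: sign_on_def)
next
  case (Cons cs css)
  let ?B = "A - set cs"
  have cs: "distinct cs" "length cs = 4" "map f cs = rotate1 cs" "set cs \<subseteq> A"
    using Cons.prems by auto
  have "map (cycle_of_list cs) cs = map f cs"
    using cyclic_rotation[OF cs(1), of 1] cs(3) by simp
  then have f_cs: "cycle_of_list cs x = f x" if "x \<in> set cs" for x
    using that by simp
  have "f ` set cs = set cs"
    using arg_cong[OF cs(3), of set] by simp
  then have "bij_betw f (set cs) (set cs)"
    using Cons.prems(2) cs(4) by (auto simp: bij_betw_def intro: inj_on_subset)
  then have bij: "bij_betw f ?B ?B"
    using bij_betw_DiffI[OF Cons.prems(2)] cs(4) by blast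
  have IH: "sign_on ?B f = (- 1) ^ length css"
    by (rule Cons.IH[OF _ bij]) (use Cons.prems in auto)
  \<comment> \<open>Images of points off \<open>cs\<close> stay off \<open>cs\<close>, so applying
    the cycle after the rest of \<open>f\<close> does not disturb them.\<close>
  have "f x \<notin> set cs" if "x \<in> ?B" for x
    using that bij by (auto dest: bij_betwE)
  then have "restrict_id f A = cycle_of_list cs \<circ> restrict_id f ?B"
    using f_cs cs(4) by (auto simp: fun_eq_iff restrict_id_def id_outside_supp)
  then have "sign_on A f = sign (cycle_of_list cs) * sign (restrict_id f ?B)"
    using sign_compose[OF permutation_of_cycle permutes_imp_permutation[OF _ permutes_restrict_id[OF bij]]]
      Cons.prems(1) by (simp add: sign_on_def)
  moreover obtain a b c d where "cs = [a, b, c, d]"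
    using cs(2) by (auto simp: numeral_eq_Suc length_Suc_conv)
  ultimately show ?case
    using IH sign_cycle4[of a b c d] cs(1) by (simp add: sign_on_def del: cycle_of_list.simps)
qed

section \<open>Moves and center corner orbits\<close>

lemma UNIV_face: "(UNIV :: face set) = set [Up, Down, Front, Back, Right, Left]"
  using face.exhaust by auto

lemma finite_faces: "finite (UNIV :: face set)"
  unfolding UNIV_face by (rule finite_set)

lemma card_faces: "card (UNIV :: face set) = 6"
  unfolding UNIV_face by (subst distinct_card) simp_all

lemma finite_center_corner_orbit: "finite (center_corner_orbit n m)"
  by (simp add: center_corner_orbit_def finite_faces)

lemma center_corner_orbit_subset:
  "1 \<le> m \<Longrightarrow> m \<le> n div 2 \<Longrightarrow> center_corner_orbit n m \<subseteq> facelets n"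
  by (auto simp: center_corner_orbit_def facelets_def)

text \<open>The new coordinates are old ones, their mirror images, or \<open>k\<close> and
  \<open>n + 1 - k\<close>. The last two arise only when an old coordinate is one of them, and then
  both lie in \<open>M\<close>.\<close>

lemma side_turn_closed:
  assumes "\<And>x. x \<in> M \<Longrightarrow> Suc n - x \<in> M" "Suc n - k \<in> M \<longleftrightarrow> k \<in> M" "r \<in> M" "c \<in> M"
  shows "side_turn n X k (Y, r, c) \<in> UNIV \<times> M \<times> M"
  using assms(3,4) by (cases X; cases Y) (auto simp: assms(1,2))

lemma turn_in_center_corner_orbit:
  assumes "1 \<le> k" "k \<le> n div 2" "1 \<le> m" "m \<le> n div 2" "x \<in> center_corner_orbit n m"
  shows "turn n X k x \<in> center_corner_orbit n m"
proof -
  define M where "M = {m, Suc n - m}"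
  then have orbit: "center_corner_orbit n m = UNIV \<times> M \<times> M"
    by (simp add: center_corner_orbit_def)
  obtain Y r c where x: "x = (Y, r, c)" "r \<in> M" "c \<in> M"
    using assms(5) by (auto simp: orbit)
  have M: "Suc n - y \<in> M" if "y \<in> M" for y
    using that assms(3,4) by (auto simp: M_def)
  have "side_turn n X k x \<in> UNIV \<times> M \<times> M"
    unfolding x(1)
  proof (rule side_turn_closed)
    have "Suc n - k \<in> M \<Longrightarrow> k \<in> M"
      using M[of "Suc n - k"] assms(1,2) by simp
    then show "Suc n - k \<in> M \<longleftrightarrow> k \<in> M" using M by blast
  qed (use x M in auto)
  moreover have "x \<in> facelets n"
    using assms center_corner_orbit_subset by blast
  ultimately show ?thesis
    using x M by (simp add: turn_def orbit)
qed

lemma bij_betw_turn_orbit: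
  assumes "1 \<le> k" "k \<le> n div 2" "1 \<le> m" "m \<le> n div 2"
  shows "bij_betw (turn n X k) (center_corner_orbit n m) (center_corner_orbit n m)"
proof -
  have "inj_on (turn n X k) (center_corner_orbit n m)"
    using permutes_inj[OF turn_permutes[OF assms(1,2)]] inj_on_subset by blast
  moreover have "turn n X k ` center_corner_orbit n m \<subseteq> center_corner_orbit n m"
    using turn_in_center_corner_orbit[OF assms] by blast
  ultimately show ?thesis
    by (simp add: bij_betw_def endo_inj_surj finite_center_corner_orbit)
qed

text \<open>The successive positions of one side facelet under the turn of slice \<open>k\<close>.
  Here \<open>m\<close> is its coordinate along the slice on the first listed face; it becomes
  \<open>n + 1 - m\<close> on the faces where this coordinate runs the other way.\<close>

fun slice_cycle :: "nat \<Rightarrow> face \<Rightarrow> nat \<Rightarrow> nat \<Rightarrow> facelet list" where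
  "slice_cycle n Front k m = [(Up, n+1-k, m), (Right, m, k), (Down, k, n+1-m), (Left, n+1-m, n+1-k)]"
| "slice_cycle n Back k m = [(Up, k, m), (Left, n+1-m, k), (Down, n+1-k, n+1-m), (Right, m, n+1-k)]"
| "slice_cycle n Right k m = [(Up, m, n+1-k), (Back, n+1-m, k), (Down, m, n+1-k), (Front, m, n+1-k)]"
| "slice_cycle n Left k m = [(Up, m, k), (Front, m, k), (Down, m, k), (Back, n+1-m, n+1-k)]"
| "slice_cycle n Up k m = [(Front, k, m), (Left, k, m), (Back, k, m), (Right, k, m)]"
| "slice_cycle n Down k m = [(Front, n+1-k, m), (Right, n+1-k, m), (Back, n+1-k, m), (Left, n+1-k, m)]"

definition face_cycle :: "nat \<Rightarrow> face \<Rightarrow> nat \<Rightarrow> facelet list" where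
  "face_cycle n X m = [(X, m, m), (X, m, n+1-m), (X, n+1-m, n+1-m), (X, n+1-m, m)]"

lemma turn_eval:
  assumes "(Y, r, c) \<in> facelets n"
  shows "turn n X k (Y, r, c) =
    (if Y = X then if k = 1 then (X, c, Suc n - r) else (Y, r, c) else side_turn n X k (Y, r, c))"
  using assms by (simp add: turn_def)

text \<open>Stated for a coordinate \<open>k\<close> and its mirror image \<open>k'\<close>, so that no subtraction occurs in the proofs.\<close>

locale mirrored =
  fixes n k k' :: nat
  assumes mirror: "Suc n - k = k'" "Suc n - k' = k" "k \<noteq> k'" "0 < k" "0 < k'" "k \<le> n" "k' \<le> n"
begin

lemma in_facelets: "r \<in> {k, k'} \<Longrightarrow> c \<in> {k, k'} \<Longrightarrow> (Y, r, c) \<in> facelets n"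
  using mirror by (auto simp: facelets_def)

lemma distinct_slice_cycles: "distinct (slice_cycle n X k k @ slice_cycle n X k k')"
  using mirror(3) by (cases X) (simp_all add: mirror(1,2))

lemma turn_slice_cycle:
  "m \<in> {k, k'} \<Longrightarrow> map (turn n X k) (slice_cycle n X k m) = rotate1 (slice_cycle n X k m)"
  using mirror(3) by (cases X; elim insertE emptyE; simp add: turn_eval in_facelets mirror(1,2))

lemma slice_cycle_in_orbit:
  "m \<in> {k, k'} \<Longrightarrow> set (slice_cycle n X k m) \<subseteq> UNIV \<times> {k, k'} \<times> {k, k'}"
  by (cases X; elim insertE emptyE; simp add: mirror(1,2))

text \<open>Slice \<open>k\<close> contains two facelets of the orbit on each of the four adjacent
  faces, and the two cycles list all eight. This shows that the turn fixes the remaining points off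
  the face \<open>X\<close>, as \<open>sign_on_cycles4\<close> demands.\<close>

lemma notin_slice_cycles_iff:
  "r \<in> {k, k'} \<Longrightarrow> c \<in> {k, k'} \<Longrightarrow>
    (Y, r, c) \<notin> set (slice_cycle n X k k @ slice_cycle n X k k') \<longleftrightarrow>
    Y = X \<or> side_turn n X k (Y, r, c) = (Y, r, c)"
  using mirror(3) by (cases X; cases Y; elim insertE emptyE; simp add: mirror(1,2))

lemma distinct_face_cycle: "distinct (face_cycle n X k)"
  using mirror(3) by (simp add: face_cycle_def mirror(1,2))

lemma turn_face_cycle: "map (turn n X 1) (face_cycle n X k) = rotate1 (face_cycle n X k)"
  by (simp add: face_cycle_def turn_eval in_facelets mirror(1,2))

lemma set_face_cycle: "set (face_cycle n X k) = {X} \<times> {k, k'} \<times> {k, k'}"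
  by (auto simp: face_cycle_def mirror(1,2))

lemma side_turn_other:
  "m \<notin> {k, k'} \<Longrightarrow> Suc n - m \<notin> {k, k'} \<Longrightarrow> r \<in> {k, k'} \<Longrightarrow> c \<in> {k, k'} \<Longrightarrow>
    side_turn n X m (Y, r, c) = (Y, r, c)"
  by (cases X; cases Y) auto

lemma orbit_eq: "center_corner_orbit n k = UNIV \<times> {k, k'} \<times> {k, k'}"
  by (simp add: center_corner_orbit_def mirror(1))

end

text \<open>Given \<open>Suc n = i + j\<close>, the inequality \<open>i < j\<close> is equivalent to
  \<open>i \<le> n div 2\<close> for both parities of \<open>n\<close>.\<close>

locale center_corner =
  fixes n i j :: nat
  assumes i_ge: "2 \<le> i" and i_less_j: "i < j" and n_eq: "Suc n = i + j"
begin

sublocale inner: mirrored n i j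
  using i_ge i_less_j n_eq by unfold_locales auto

sublocale outer: mirrored n 1 n
  using i_ge i_less_j n_eq by unfold_locales auto

lemma coords_disjoint: "{i, j} \<inter> {1, n} = {}"
  using i_ge i_less_j n_eq by auto

lemma coords: "i \<noteq> Suc 0" "i \<noteq> j" "Suc n - i = j" "Suc n - j = i" "j \<noteq> Suc 0"
  using i_ge i_less_j n_eq by auto

lemma i_le_half: "1 \<le> i" "i \<le> n div 2" "1 \<le> n div 2"
  using i_ge i_less_j n_eq by auto

section \<open>Parity of the moves\<close>

abbreviation "orbit \<equiv> center_corner_orbit n i"
abbreviation "parity_set \<equiv> center_corner_orbit n i \<union> center_corner_orbit n 1"

lemma orbits_disjoint: "orbit \<inter> center_corner_orbit n 1 = {}"
  using coords_disjoint unfolding inner.orbit_eq outer.orbit_eq by blast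

lemma parity_set_coords:
  assumes "x \<in> parity_set"
  obtains Y r c where "x = (Y, r, c)" "r \<in> {i, j} \<and> c \<in> {i, j} \<or> r \<in> {1, n} \<and> c \<in> {1, n}"
  using assms unfolding inner.orbit_eq outer.orbit_eq by blast

lemma finite_parity_set: "finite parity_set"
  by (simp add: finite_center_corner_orbit)

lemma bij_betw_turn_parity_set:
  assumes "1 \<le> k" "k \<le> n div 2"
  shows "bij_betw (turn n X k) parity_set parity_set"
  using bij_betw_combine[OF bij_betw_turn_orbit bij_betw_turn_orbit orbits_disjoint]
    assms i_le_half by simp

lemma side_turn_inner_orbit:
  assumes "1 \<le> k" "k \<le> n div 2" "k \<noteq> i" "r \<in> {i, j}" "c \<in> {i, j}"
  shows "side_turn n X k (Y, r, c) = (Y, r, c)"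
  by (rule inner.side_turn_other) (use assms i_less_j n_eq in auto)

lemma side_turn_outer_orbit:
  assumes "1 < k" "k \<le> n div 2" "r \<in> {1, n}" "c \<in> {1, n}"
  shows "side_turn n X k (Y, r, c) = (Y, r, c)"
  by (rule outer.side_turn_other) (use assms in auto)

lemma sign_on_turn_first: "sign_on parity_set (turn n X 1) = 1"
proof -
  \<comment> \<open>On the turned face there is one cycle of corner stickers and one of orbit
    \<open>i\<close>. The other two move corner stickers on the adjacent faces, where the first
    slice contains no facelet of orbit \<open>i\<close>.\<close>
  let ?css = "[face_cycle n X 1, face_cycle n X i, slice_cycle n X 1 1, slice_cycle n X 1 n]"
  have sl: "Y \<noteq> X \<and> r \<in> {1, n} \<and> c \<in> {1, n}"
    if "(Y, r, c) \<in> set (slice_cycle n X 1 1 @ slice_cycle n X 1 n)" for Y r c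
  proof -
    have rc: "r \<in> {1, n}" "c \<in> {1, n}"
      using that outer.slice_cycle_in_orbit[of 1 X] outer.slice_cycle_in_orbit[of n X] by auto
    with that outer.notin_slice_cycles_iff[OF rc] show ?thesis by blast
  qed
  have "sign_on parity_set (turn n X 1) = (- 1) ^ length ?css"
  proof (rule sign_on_cycles4)
    show "bij_betw (turn n X 1) parity_set parity_set"
      by (rule bij_betw_turn_parity_set) (use i_le_half in auto)
    have "set (face_cycle n X 1) \<inter> set (face_cycle n X i) = {}"
      "set (face_cycle n X 1) \<inter> set (slice_cycle n X 1 1 @ slice_cycle n X 1 n) = {}"
      "set (face_cycle n X i) \<inter> set (slice_cycle n X 1 1 @ slice_cycle n X 1 n) = {}"
      using sl coords_disjoint unfolding inner.set_face_cycle outer.set_face_cycle by blast+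
    then show "distinct (concat ?css)"
      using outer.distinct_slice_cycles outer.distinct_face_cycle inner.distinct_face_cycle by auto
    have "set (slice_cycle n X 1 m) \<subseteq> parity_set" if "m \<in> {1, n}" for m
      using outer.slice_cycle_in_orbit[OF that] unfolding outer.orbit_eq by blast
    moreover have "set (face_cycle n X 1) \<subseteq> parity_set" "set (face_cycle n X i) \<subseteq> parity_set"
      unfolding inner.orbit_eq outer.orbit_eq inner.set_face_cycle outer.set_face_cycle by blast+
    ultimately show "set (concat ?css) \<subseteq> parity_set"
      by simp
    show "length cs = 4 \<and> map (turn n X 1) cs = rotate1 cs" if "cs \<in> set ?css" for cs
    proof
      show "length cs = 4"
        using that by (cases X) (auto simp: face_cycle_def)
      show "map (turn n X 1) cs = rotate1 cs"
        using that outer.turn_slice_cycle[of 1 X] outer.turn_slice_cycle[of n X]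
          inner.turn_face_cycle outer.turn_face_cycle by auto
    qed
    show "turn n X 1 x = x" if "x \<in> parity_set - set (concat ?css)" for x
    proof -
      from that have "x \<in> parity_set" by simp
      then obtain Y r c where x: "x = (Y, r, c)"
        and rc: "r \<in> {i, j} \<and> c \<in> {i, j} \<or> r \<in> {1, n} \<and> c \<in> {1, n}"
        by (rule parity_set_coords)
      have "x \<notin> set (face_cycle n X 1)" "x \<notin> set (face_cycle n X i)"
        using that by simp_all
      then have nX: "Y \<noteq> X"
        using rc unfolding x inner.set_face_cycle outer.set_face_cycle by blast
      consider "r \<in> {i, j}" "c \<in> {i, j}" | "r \<in> {1, n}" "c \<in> {1, n}"
        using rc by blast
      then show ?thesis
      proof cases
        case 1
        with nX show ?thesis
          unfolding x turn_eval[OF inner.in_facelets[OF 1]]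
          using side_turn_inner_orbit[of 1 r c X Y] i_ge i_le_half by auto
      next
        case 2
        then have "Y = X \<or> side_turn n X 1 x = x"
          using outer.notin_slice_cycles_iff[OF 2, of Y X] that by (simp add: x)
        with nX show ?thesis
          unfolding x turn_eval[OF outer.in_facelets[OF 2]] by auto
      qed
    qed
  qed (rule finite_parity_set)
  then show ?thesis by simp
qed

lemma sign_on_turn_inner: "sign_on parity_set (turn n X i) = 1"
proof -
  \<comment> \<open>Both cycles lie in orbit \<open>i\<close>; the slice contains no corner sticker
    because \<open>1 < i\<close> and \<open>i \<le> n div 2\<close>.\<close>
  let ?css = "[slice_cycle n X i i, slice_cycle n X i j]"
  have "sign_on parity_set (turn n X i) = (- 1) ^ length ?css"
  proof (rule sign_on_cycles4)
    show "bij_betw (turn n X i) parity_set parity_set"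
      by (rule bij_betw_turn_parity_set) (use i_le_half in auto)
    show "distinct (concat ?css)"
      using inner.distinct_slice_cycles by simp
    show "set (concat ?css) \<subseteq> parity_set"
      using inner.slice_cycle_in_orbit[of i X] inner.slice_cycle_in_orbit[of j X]
      by (auto simp: inner.orbit_eq)
    show "length cs = 4 \<and> map (turn n X i) cs = rotate1 cs" if "cs \<in> set ?css" for cs
    proof
      show "length cs = 4"
        using that by (cases X) auto
      show "map (turn n X i) cs = rotate1 cs"
        using that inner.turn_slice_cycle[of i X] inner.turn_slice_cycle[of j X] by auto
    qed
    show "turn n X i x = x" if "x \<in> parity_set - set (concat ?css)" for x
    proof -
      from that have "x \<in> parity_set" by simp
      then obtain Y r c where x: "x = (Y, r, c)"
        and rc: "r \<in> {i, j} \<and> c \<in> {i, j} \<or> r \<in> {1, n} \<and> c \<in> {1, n}"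
        by (rule parity_set_coords)
      from rc consider "r \<in> {i, j}" "c \<in> {i, j}" | "r \<in> {1, n}" "c \<in> {1, n}"
        by blast
      then show ?thesis
      proof cases
        case 1
        then have "Y = X \<or> side_turn n X i x = x"
          using inner.notin_slice_cycles_iff[OF 1, of Y X] that by (simp add: x)
        then show ?thesis
          unfolding x turn_eval[OF inner.in_facelets[OF 1]] using i_ge by auto
      next
        case 2
        then show ?thesis
          unfolding x turn_eval[OF outer.in_facelets[OF 2]]
          using side_turn_outer_orbit[of i r c X Y] i_ge i_le_half by auto
      qed
    qed
  qed (rule finite_parity_set)
  then show ?thesis by simp
qed

lemma sign_on_turn:
  assumes "1 \<le> k" "k \<le> n div 2"
  shows "sign_on parity_set (turn n X k) = 1"
proof -
  consider "k = 1" | "k = i" | "k \<noteq> 1" "k \<noteq> i" by blast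
  then show ?thesis
  proof cases
    case 3
    \<comment> \<open>Such a slice touches neither orbit, so the turn agrees with \<open>id\<close>
      on \<open>parity_set\<close>.\<close>
    have "turn n X k x = x" if "x \<in> parity_set" for x
    proof -
      from that have "x \<in> parity_set" by simp
      then obtain Y r c where x: "x = (Y, r, c)"
        and rc: "r \<in> {i, j} \<and> c \<in> {i, j} \<or> r \<in> {1, n} \<and> c \<in> {1, n}"
        by (rule parity_set_coords)
      from rc consider "r \<in> {i, j}" "c \<in> {i, j}" | "r \<in> {1, n}" "c \<in> {1, n}"
        by blast
      then show ?thesis
      proof cases
        case 1
        then show ?thesis
          unfolding x turn_eval[OF inner.in_facelets[OF 1]]
          using side_turn_inner_orbit[of k r c X Y] assms 3 by auto
      next
        case 2
        then show ?thesis
          unfolding x turn_eval[OF outer.in_facelets[OF 2]]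
          using side_turn_outer_orbit[of k r c X Y] assms 3 by auto
      qed
    qed
    then have "sign_on parity_set (turn n X k) = sign_on parity_set id"
      by (intro sign_on_cong) auto
    then show ?thesis by simp
  qed (simp_all only: sign_on_turn_first sign_on_turn_inner)
qed

end

section \<open>The subgroup of elements supported on a center corner orbit\<close>

lemma bij_betw_inv_self:
  assumes "bij f" "bij_betw f A A"
  shows "bij_betw (inv' f) A A"
proof -
  have "inv' f ` A = inv' f ` f ` A" using assms(2) by (simp add: bij_betw_def)
  also have "\<dots> = A" using assms(1) by (simp add: bij_is_inj image_inv_f_f)
  finally show ?thesis
    using bij_is_inj[OF bij_imp_bij_inv[OF assms(1)]] by (auto simp: bij_betw_def intro: inj_on_subset)
qed

lemma inv_facelet_sym_group:
  assumes "p permutes facelets n"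
  shows "inv\<^bsub>facelet_sym_group n\<^esub> p = inv' p"
  by (rule group.inv_equality[OF facelet_sym_group_is_group])
    (use assms in \<open>auto simp: facelet_sym_group_def permutes_inv permutes_inv_o\<close>)

lemma rubik_permutes: "g \<in> carrier (rubik_group n) \<Longrightarrow> g permutes facelets n"
  using subgroup.subset[OF subgroup_rubik_group] by (auto simp: facelet_sym_group_def)

lemma turn_in_rubik: "1 \<le> k \<Longrightarrow> k \<le> n div 2 \<Longrightarrow> turn n X k \<in> carrier (rubik_group n)"
  by (auto simp: rubik_group_def moves_def intro!: generate.incl)

lemma comp_in_rubik:
  "g \<in> carrier (rubik_group n) \<Longrightarrow> h \<in> carrier (rubik_group n) \<Longrightarrow> g \<circ> h \<in> carrier (rubik_group n)"
  using subgroup.m_closed[OF subgroup_rubik_group] by (simp add: facelet_sym_group_def)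

lemma inv_in_rubik: "g \<in> carrier (rubik_group n) \<Longrightarrow> inv' g \<in> carrier (rubik_group n)"
  using subgroup.m_inv_closed[OF subgroup_rubik_group] inv_facelet_sym_group rubik_permutes by metis

text \<open>The cases follow the constructors of \<open>generate\<close>, which inverts generators
  only. The group operations are restated as composition and inverse of functions, the form in which
  they are used below.\<close>

lemma rubik_induct [consumes 1, case_names id turn inv_turn comp]:
  assumes "g \<in> carrier (rubik_group n)"
    and "P id"
    and turn: "\<And>X k. 1 \<le> k \<Longrightarrow> k \<le> n div 2 \<Longrightarrow> P (turn n X k)"
    and inv: "\<And>X k. 1 \<le> k \<Longrightarrow> k \<le> n div 2 \<Longrightarrow> P (inv' (turn n X k))"
    and comp: "\<And>g h. g \<in> carrier (rubik_group n) \<Longrightarrow> h \<in> carrier (rubik_group n) \<Longrightarrow> P g \<Longrightarrow> P h \<Longrightarrow> P (g \<circ> h)"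
  shows "P g"
proof -
  from assms(1) have "g \<in> generate (facelet_sym_group n) (moves n)"
    by (simp add: rubik_group_def)
  then show ?thesis
  proof induction
    case one
    have "\<one>\<^bsub>facelet_sym_group n\<^esub> = id" by (simp add: facelet_sym_group_def)
    then show ?case using \<open>P id\<close> by (simp only:)
  next
    case (incl h)
    then show ?case using turn by (auto simp: moves_def)
  next
    case (inv h)
    then obtain X k where h: "h = turn n X k" "1 \<le> k" "k \<le> n div 2" by (auto simp: moves_def)
    show ?case
      unfolding h(1) inv_facelet_sym_group[OF turn_permutes[OF h(2,3)]] by (rule assms(4)[OF h(2,3)])
  next
    case (eng g h)
    have "g \<otimes>\<^bsub>facelet_sym_group n\<^esub> h = g \<circ> h" by (simp add: facelet_sym_group_def)
    moreover have "P (g \<circ> h)"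
      by (rule comp) (use eng in \<open>simp_all add: rubik_group_def\<close>)
    ultimately show ?case by (simp only:)
  qed
qed

section \<open>Evenness and normality of \<open>Z\<close>\<close>

context center_corner
begin

abbreviation "Z \<equiv> Z_center_corner n i"

lemma bij_betw_rubik_orbit:
  "g \<in> carrier (rubik_group n) \<Longrightarrow> bij_betw g orbit orbit"
proof (induction rule: rubik_induct)
  case (turn X k)
  then show ?case using bij_betw_turn_orbit i_le_half by blast
next
  case (inv_turn X k)
  then have "bij_betw (turn n X k) orbit orbit" using bij_betw_turn_orbit i_le_half by blast
  then show ?case
    by (rule bij_betw_inv_self[OF permutes_bij[OF turn_permutes[OF inv_turn]]])
next
  case (comp g h)
  then show ?case using bij_betw_trans by blast
qed (rule bij_betw_id)

text \<open>Bijectivity accompanies the sign in the induction because multiplicativity of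
  \<open>sign_on\<close> relies on it. The sign of an inverse turn is read off from its composition
  with the turn, which is \<open>id\<close>.\<close>

lemma sign_on_rubik:
  assumes "g \<in> carrier (rubik_group n)"
  shows "bij_betw g parity_set parity_set \<and> sign_on parity_set g = 1"
  using assms
proof (induction rule: rubik_induct)
  case (turn X k)
  then show ?case using bij_betw_turn_parity_set sign_on_turn by blast
next
  case (inv_turn X k)
  let ?t = "turn n X k"
  have t: "bij_betw ?t parity_set parity_set" using bij_betw_turn_parity_set inv_turn by blast
  have bij: "bij ?t" using permutes_bij[OF turn_permutes[OF inv_turn]] .
  then have inv: "bij_betw (inv' ?t) parity_set parity_set"
    using t by (rule bij_betw_inv_self)
  have "sign_on parity_set (inv' ?t \<circ> ?t) = 1"
    unfolding inv_o_cancel[OF bij_is_inj[OF bij]] by (rule sign_on_id)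
  then have "sign_on parity_set (inv' ?t) = 1"
    unfolding sign_on_compose[OF inv t finite_parity_set] sign_on_turn[OF inv_turn] by simp
  with inv show ?case by blast
next
  case (comp g h)
  then have g: "bij_betw g parity_set parity_set" and h: "bij_betw h parity_set parity_set"
    by blast+
  have "sign_on parity_set (g \<circ> h) = 1"
    unfolding sign_on_compose[OF g h finite_parity_set] using comp by (simp del: One_nat_def)
  then show ?case
    using bij_betw_trans[OF h g] by blast
next
  case id
  show ?case using bij_betw_id sign_on_id by blast
qed

text \<open>Cube group elements are the identity outside \<open>facelets n\<close>, so fixing the
  facelets off the orbit amounts to being a permutation supported on it.\<close>

lemma Z_iff: "z \<in> Z \<longleftrightarrow> z \<in> carrier (rubik_group n) \<and> z permutes orbit"
proof -
  have "z permutes orbit" if "z permutes facelets n" "\<forall>x \<in> facelets n - orbit. z x = x"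
    using that permutes_superset by blast
  then show ?thesis
    using rubik_permutes[of z n] by (auto simp: Z_center_corner_def permutes_not_in)
qed

text \<open>An element of \<open>Z\<close> acts only within \<open>parity_set\<close>, so its sign
  is its sign on that set, which is 1 throughout the cube group.\<close>

lemma Z_even: "z \<in> Z \<Longrightarrow> evenperm z"
  using sign_on_rubik[of z] sign_on_permutes[of z orbit parity_set] 
  by (auto simp: Z_iff sign_def split: if_splits)

sublocale comp_closed Z
  by unfold_locales (auto simp: Z_iff comp_in_rubik permutes_compose)

lemma inv_in_Z: "z \<in> Z \<Longrightarrow> inv' z \<in> Z"
  by (auto simp: Z_iff inv_in_rubik permutes_inv)

lemma id_in_Z: "id \<in> Z"
  using subgroup.one_closed[OF subgroup_Z_center_corner[of n i]]
  by (simp add: rubik_group_def facelet_sym_group_def)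

text \<open>Cube group elements preserve \<open>orbit\<close>, so a conjugate is again supported
  there.\<close>

lemma conj_in_Z:
  assumes "g \<in> carrier (rubik_group n)" "z \<in> Z"
  shows "g \<circ> z \<circ> inv' g \<in> Z"
proof -
  have g: "bij g" using rubik_permutes[OF assms(1)] permutes_bij by blast
  have "(g \<circ> z \<circ> inv' g) x = x" if "x \<notin> orbit" for x
  proof -
    have "inv' g x \<notin> orbit"
      using that bij_betw_rubik_orbit[OF assms(1)] g by (metis bij_betwE bij_inv_eq_iff)
    then have "z (inv' g x) = inv' g x"
      using assms(2) Z_iff permutes_not_in by metis
    then show ?thesis
      using g by (simp add: bij_is_surj surj_f_inv_f)
  qed
  then show ?thesis
    using assms by (auto simp: Z_center_corner_def intro!: comp_in_rubik inv_in_rubik)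
qed

section \<open>Linking all facelets of the orbit\<close>

abbreviation linked (infix "\<sim>" 50) where "linked \<equiv> in_common_cycle3 Z"

lemma linked_turn:
  assumes "1 \<le> k" "k \<le> n div 2" "a \<sim> b"
  shows "turn n X k a \<sim> turn n X k b"
  using in_common_cycle3_conj[OF permutes_bij[OF turn_permutes[OF assms(1,2)]]
      conj_in_Z[OF turn_in_rubik[OF assms(1,2)]] assms(3)] .

text \<open>The inner slices of \<open>Right\<close> and \<open>Down\<close> cross on the face
  \<open>Front\<close> at \<open>(Front, j, j)\<close>. The turn \<open>?R\<close> brings that
  facelet to \<open>(Up, j, j)\<close>, the only point moved by both \<open>f\<close> and
  \<open>?U\<close>.\<close>

lemma basic_cycle3:
  "distinct [(Up, j, j), (Right, j, j), (Up, j, i)]"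
  "cycle_of_list [(Up, j, j), (Right, j, j), (Up, j, i)] \<in> Z"
proof -
  let ?R = "turn n Right i" and ?D = "turn n Down i" and ?U = "turn n Up 1"
  define f where "f = ?R \<circ> ?D \<circ> inv' ?R"
  have R: "bij ?R" and D: "bij ?D" and U: "bij ?U"
    using permutes_bij[OF turn_permutes] i_le_half by blast+
  have f: "bij f" unfolding f_def using R D by (intro bij_comp bij_imp_bij_inv)
  have fR: "f (?R y) = ?R (?D y)" for y
    unfolding f_def using R by (simp add: bij_is_inj)
  have Rp: "?R (Front, j, j) = (Up, j, j)"
    by (simp add: turn_eval inner.in_facelets coords)
  have fp: "f (Up, j, j) = (Right, j, j)"
    unfolding Rp[symmetric] fR by (simp add: turn_eval inner.in_facelets coords)
  have Up: "?U (Up, j, j) = (Up, j, i)"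
    by (simp add: turn_eval inner.in_facelets coords)
  \<comment> \<open>\<open>f\<close> moves \<open>?R y\<close> only if \<open>?D\<close> moves
    \<open>y\<close>, so \<open>y\<close> lies in row \<open>j\<close> of a side face. Among these
    facelets \<open>?R\<close> brings only \<open>(Front, j, j)\<close> to the face
    \<open>Up\<close>, and it brings none to row 1.\<close>
  have meet: "x = (Up, j, j)" if "f x \<noteq> x" "?U x \<noteq> x" for x
  proof -
    obtain y where y: "x = ?R y" using R by (metis bij_pointE)
    then have Dy: "?D y \<noteq> y" using that(1) fR by metis
    obtain Y r c where ye: "y = (Y, r, c)" by (metis prod_cases3)
    have yf: "(Y, r, c) \<in> facelets n"
      using Dy unfolding ye by (metis turn_def)
    have r: "r = j" "Y \<noteq> Up" "Y \<noteq> Down"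
      using Dy unfolding ye turn_eval[OF yf] 
      by (cases Y; simp add: coords split: if_splits)+
    obtain Y' r' c' where x: "x = (Y', r', c')" by (metis prod_cases3)
    have xf: "(Y', r', c') \<in> facelets n" using that(2) unfolding x by (metis turn_def)
    have "Y' = Up \<or> r' = 1"
      using that(2) unfolding x turn_eval[OF xf] by (cases Y'; simp split: if_splits)
    moreover have "(Y', r', c') = (if Y = Right then (Y, r, c) else side_turn n Right i (Y, r, c))"
      using y coords(1) unfolding x ye turn_eval[OF yf] by simp
    ultimately show ?thesis
      using r coords by (cases Y; simp add: x split: if_splits)
  qed
  have "f (Up, j, j) \<noteq> (Up, j, j)" "?U (Up, j, j) \<noteq> (Up, j, j)"
    unfolding fp Up using coords by auto
  note comm = commutator_eq_cycle3[OF f U meet this]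
  show d: "distinct [(Up, j, j), (Right, j, j), (Up, j, i)]"
    using comm(1) unfolding fp Up .
  have "f \<circ> ?U \<circ> inv' f \<circ> inv' ?U \<in> carrier (rubik_group n)"
    unfolding f_def using i_le_half by (intro comp_in_rubik inv_in_rubik turn_in_rubik) auto
  moreover have "cycle_of_list [(Up, j, j), (Right, j, j), (Up, j, i)] permutes orbit"
    by (rule permutes_subset[OF cycle_permutes]) (auto simp: inner.orbit_eq)
  ultimately show "cycle_of_list [(Up, j, j), (Right, j, j), (Up, j, i)] \<in> Z"
    using comm(2) unfolding fp Up by (simp add: Z_iff del: cycle_of_list.simps)
qed

text \<open>The outer turn of \<open>X\<close> permutes its four orbit facelets cyclically, so a
  link between two consecutive ones propagates around the face.\<close>

lemma linked_face:
  assumes "r \<in> {i, j}" "c \<in> {i, j}" "(X, r, c) \<sim> (X, c, Suc n - r)"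
    and "r' \<in> {i, j}" "c' \<in> {i, j}"
  shows "(X, r, c) \<sim> (X, r', c')"
proof -
  have rot: "(X, b, Suc n - a) \<sim> (X, Suc n - a, Suc n - b)"
    if "(X, a, b) \<sim> (X, b, Suc n - a)" "a \<in> {i, j}" "b \<in> {i, j}" for a b
    using linked_turn[OF _ _ that(1), of 1 X] i_le_half that(2,3) coords
    by (auto simp: turn_eval inner.in_facelets)
  have s1: "(X, c, Suc n - r) \<sim> (X, Suc n - r, Suc n - c)"
    using rot[OF assms(3,1,2)] .
  then have s2: "(X, Suc n - r, Suc n - c) \<sim> (X, Suc n - c, r)"
    using rot[of c "Suc n - r"] assms(1,2) coords by auto
  note t1 = in_common_cycle3_trans[OF assms(3) s1]
  note t2 = in_common_cycle3_trans[OF t1 s2]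
  have "(X, r, c) \<sim> (X, r, c)" by (simp add: in_common_cycle3_def)
  moreover have "(r', c') \<in> {(r, c), (c, Suc n - r), (Suc n - r, Suc n - c), (Suc n - c, r)}"
    using assms(1,2,4,5) coords(2) by (elim insertE emptyE; simp add: coords(3,4))
  ultimately show ?thesis
    using assms(3) t1 t2 by blast
qed

lemma turn_inner:
  assumes "r \<in> {i, j}" "c \<in> {i, j}"
  shows "turn n X i (Y, r, c) = (if Y = X then (Y, r, c) else side_turn n X i (Y, r, c))"
  using i_ge by (simp add: turn_eval inner.in_facelets[OF assms])

lemma linked_turn_inner: "a \<sim> b \<Longrightarrow> turn n X i a \<sim> turn n X i b"
  using linked_turn i_le_half by blast

lemma linked_on_face:
  assumes "r \<in> {i, j}" "c \<in> {i, j}" "r' \<in> {i, j}" "c' \<in> {i, j}"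
  shows "(X, r, c) \<sim> (X, r', c')"
proof -
  have all: "(Y, a, b) \<sim> (Y, a', b')"
    if "(Y, j, i) \<sim> (Y, i, i)" "a \<in> {i, j}" "b \<in> {i, j}" "a' \<in> {i, j}" "b' \<in> {i, j}" for Y a b a' b'
    by (rule in_common_cycle3_trans[OF in_common_cycle3_sym[OF linked_face] linked_face, of j i])
      (use that coords in simp_all)
  \<comment> \<open>The inverse of the basic cycle has \<open>(Up, j, i)\<close> in second
    place.\<close>
  have "(Up, j, j) \<sim> (Up, j, i)"
    using basic_cycle3(1) cycle3_inverse_in[OF basic_cycle3] unfolding in_common_cycle3_def by auto
  then have U0: "(Up, j, j) \<sim> (Up, a, b)" if "a \<in> {i, j}" "b \<in> {i, j}" for a b
    using linked_face[of j j Up a b] that coords by simp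
  then have U: "(Up, a, b) \<sim> (Up, a', b')"
    if "a \<in> {i, j}" "b \<in> {i, j}" "a' \<in> {i, j}" "b' \<in> {i, j}" for a b a' b'
    using that by (intro in_common_cycle3_trans[OF in_common_cycle3_sym[OF U0] U0])
  \<comment> \<open>Each inner slice below carries a linked pair from \<open>Up\<close> (for
    \<open>Down\<close>, from \<open>Front\<close>) to another face, where it becomes the
    consecutive pair \<open>(j, i)\<close>, \<open>(i, i)\<close> that \<open>all\<close> starts
    from.\<close>
  have F: "(Front, j, i) \<sim> (Front, i, i)"
    using linked_turn_inner[OF U[of j i i i], of Left] coords by (simp add: turn_inner)
  have "(Right, j, i) \<sim> (Right, i, i)"
    using linked_turn_inner[OF U[of j j j i], of Front] coords by (simp add: turn_inner)
  moreover have "(Left, j, i) \<sim> (Left, i, i)"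
    using linked_turn_inner[OF U[of i i i j], of Back] coords by (simp add: turn_inner)
  moreover have "(Back, j, i) \<sim> (Back, i, i)"
    using linked_turn_inner[OF U[of i j j j], of Right] coords by (simp add: turn_inner)
  moreover have "(Down, j, i) \<sim> (Down, i, i)"
    using linked_turn_inner[OF F, of Left] coords by (simp add: turn_inner)
  moreover have "(Up, j, i) \<sim> (Up, i, i)" by (rule U) auto
  ultimately have "(X, j, i) \<sim> (X, i, i)" using F by (cases X) auto
  then show ?thesis using all assms by blast
qed

lemma linked_faces: "(Up, j, j) \<sim> (X, i, i)"
proof -
  \<comment> \<open>The inner slice of \<open>Up\<close> leaves the face \<open>Up\<close> in place,
    so only the second facelet travels: from \<open>Right\<close> to \<open>Front\<close>,
    \<open>Left\<close> and \<open>Back\<close>.\<close>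
  have step: "(Up, j, j) \<sim> turn n Up i x" if "(Up, j, j) \<sim> x" for x
    using linked_turn_inner[OF that, of Up] by (simp add: turn_inner)
  have "(Up, j, j) \<sim> (Right, j, j)"
    using basic_cycle3 unfolding in_common_cycle3_def by blast
  then have R: "(Up, j, j) \<sim> (Right, i, i)"
    by (rule in_common_cycle3_trans) (rule linked_on_face; simp)
  have F: "(Up, j, j) \<sim> (Front, i, i)"
    using step[OF R] coords by (simp add: turn_inner)
  have L: "(Up, j, j) \<sim> (Left, i, i)"
    using step[OF F] coords by (simp add: turn_inner)
  have B: "(Up, j, j) \<sim> (Back, i, i)"
    using step[OF L] coords by (simp add: turn_inner)
  have "(Right, i, i) \<sim> (Front, i, i)"
    using in_common_cycle3_trans[OF in_common_cycle3_sym[OF R] F] .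
  \<comment> \<open>The inner slice of \<open>Left\<close> leaves the opposite face
    \<open>Right\<close> in place and takes \<open>(Front, i, i)\<close> to
    \<open>Down\<close>.\<close>
  from linked_turn_inner[OF this, of Left] have "(Right, i, i) \<sim> (Down, i, i)"
    using coords by (simp add: turn_inner)
  then have D: "(Up, j, j) \<sim> (Down, i, i)"
    using in_common_cycle3_trans[OF R] by blast
  have "(Up, j, j) \<sim> (Up, i, i)" by (rule linked_on_face) auto
  with R F L B D show ?thesis by (cases X) auto
qed

lemma linked_orbit:
  assumes "x \<in> orbit" "y \<in> orbit"
  shows "x \<sim> y"
proof -
  have base: "(Up, j, j) \<sim> z" if z: "z \<in> orbit" for z
  proof -
    obtain X r c where z: "z = (X, r, c)" "r \<in> {i, j}" "c \<in> {i, j}"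
      using z unfolding inner.orbit_eq by blast
    then show ?thesis
      using in_common_cycle3_trans[OF linked_faces linked_on_face[of i i r c X]] by simp
  qed
  show ?thesis
    using in_common_cycle3_trans[OF in_common_cycle3_sym[OF base[OF assms(1)]] base[OF assms(2)]] .
qed

lemma cycle3_in_Z:
  assumes "distinct [a, b, c]" "{a, b, c} \<subseteq> orbit"
  shows "cycle_of_list [a, b, c] \<in> Z"
proof (rule cycle3_in_if_connected[OF linked_orbit _ assms(1)])
  show "x \<in> orbit" if "p \<in> Z" "p x \<noteq> x" for p x
    using that Z_iff permutes_not_in by metis
qed (use assms(2) in auto)

section \<open>Transport to the alternating group\<close>

lemma card_orbit: "card orbit = 24"
  using inner.mirror(3) by (simp add: inner.orbit_eq card_cartesian_product card_faces)

text \<open>The even permutations whose transport along \<open>f\<close> lies in \<open>Z\<close>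
  form a subgroup. It contains the 3-cycles, and these generate the alternating group.\<close>

lemma map_permutation_alt_in_Z:
  assumes f: "bij_betw f {1..m} orbit" and p: "p \<in> carrier (alt_group m)"
  shows "map_permutation {1..m} f p \<in> Z"
proof -
  let ?h = "map_permutation {1..m} f"
  have inj: "inj_on f {1..m}" and im: "f ` {1..m} = orbit" using f by (auto simp: bij_betw_def)
  interpret alt: group "alt_group m" by (rule alt_group_is_group)
  let ?H = "{p \<in> carrier (alt_group m). ?h p \<in> Z}"
  have comp: "?h (p \<circ> q) = ?h p \<circ> ?h q" if "q \<in> carrier (alt_group m)" for p q
    using map_permutation_compose'[OF inj] that alt_group_carrier by blast
  have "subgroup ?H (alt_group m)"
  proof (rule alt.subgroupI)
    have "id \<in> carrier (alt_group m)"
      using alt.one_closed unfolding alt_group_one .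
    moreover have "?h id \<in> Z"
      unfolding map_permutation_id'[OF inj] by (rule id_in_Z)
    ultimately show "?H \<noteq> {}" by blast
  next
    fix p assume p: "p \<in> ?H"
    then have inv: "inv\<^bsub>alt_group m\<^esub> p \<in> carrier (alt_group m)" "inv\<^bsub>alt_group m\<^esub> p = inv' p"
      using alt.inv_closed[of p] alt_group_inv_equality by blast+
    have pp: "p permutes {1..m}" using p alt_group_carrier by blast
    have pc: "p \<in> carrier (alt_group m)" using p by blast
    have "?h p \<circ> ?h (inv' p) = id"
      unfolding comp[OF inv(1)[unfolded inv(2)], symmetric] permutes_inv_o(1)[OF pp]
      by (rule map_permutation_id'[OF inj])
    moreover have "?h (inv' p) \<circ> ?h p = id"
      unfolding comp[OF pc, symmetric] permutes_inv_o(2)[OF pp]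
      by (rule map_permutation_id'[OF inj])
    ultimately have "inv' (?h p) = ?h (inv' p)"
      by (rule inv_unique_comp)
    then have "?h (inv' p) \<in> Z"
      using inv_in_Z[of "?h p"] p by (metis (mono_tags) mem_Collect_eq)
    then show "inv\<^bsub>alt_group m\<^esub> p \<in> ?H"
      using inv by (simp only: mem_Collect_eq)
  next
    fix p q assume "p \<in> ?H" "q \<in> ?H"
    then show "p \<otimes>\<^bsub>alt_group m\<^esub> q \<in> ?H"
      using alt.m_closed[of p q] comp[of q p] comp_closed by (simp add: alt_group_mult)
  qed auto
  moreover have "three_cycles m \<subseteq> ?H"
  proof
    fix p assume p3: "p \<in> three_cycles m"
    then obtain cs where cs: "p = cycle_of_list cs" "distinct cs" "length cs = 3" "set cs \<subseteq> {1..m}"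
      by blast
    obtain a b c where abc: "cs = [a, b, c]"
      using cs(3) by (auto simp: numeral_eq_Suc length_Suc_conv)
    have "distinct (map f cs)"
      using cs(2) inj_on_subset[OF inj cs(4)] by (simp add: distinct_map)
    then have d: "distinct [f a, f b, f c]"
      unfolding abc list.map .
    have in_dom: "a \<in> {1..m}" "b \<in> {1..m}" "c \<in> {1..m}"
      using cs(4) unfolding abc by simp_all
    have "?h p = ?h (transpose a b) \<circ> ?h (transpose b c)"
      unfolding cs(1) abc cycle_of_list.simps comp_id
      by (rule map_permutation_compose'[OF inj permutes_swap_id[OF in_dom(2,3)]])
    also have "\<dots> = cycle_of_list [f a, f b, f c]"
      unfolding map_permutation_transpose[OF inj in_dom(1,2)] map_permutation_transpose[OF inj in_dom(2,3)]
      by simp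
    also have "\<dots> \<in> Z"
      by (rule cycle3_in_Z[OF d]) (use in_dom im in blast)
    finally show "p \<in> ?H"
      using three_cycles_incl p3 by blast
  qed
  ultimately have "generate (alt_group m) (three_cycles m) \<subseteq> ?H"
    by (intro alt.generate_subgroup_incl)
  then show ?thesis
    using p unfolding alt_group_carrier_as_three_cycles by blast
qed

lemma Z_iso_alt_group: "(rubik_group n)\<lparr>carrier := Z\<rparr> \<cong> alt_group 24"
proof -
  obtain f where f: "bij_betw f {1..24::nat} orbit"
    using card_orbit finite_center_corner_orbit ex_bij_betw_nat_finite_1 by metis
  let ?h = "map_permutation {1..24} f"
  have inj: "inj_on f {1..24}" using f by (auto simp: bij_betw_def)
  have "?h \<in> hom (alt_group 24) ((rubik_group n)\<lparr>carrier := Z\<rparr>)"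
  proof (rule homI)
    show "?h p \<in> carrier ((rubik_group n)\<lparr>carrier := Z\<rparr>)" if "p \<in> carrier (alt_group 24)" for p
      using map_permutation_alt_in_Z[OF f that] by simp
    show "?h (p \<otimes>\<^bsub>alt_group 24\<^esub> q) = ?h p \<otimes>\<^bsub>(rubik_group n)\<lparr>carrier := Z\<rparr>\<^esub> ?h q"
      if "p \<in> carrier (alt_group 24)" "q \<in> carrier (alt_group 24)" for p q
      using map_permutation_compose'[OF inj, of q p] that(2)
      by (simp add: alt_group_mult alt_group_carrier rubik_group_def facelet_sym_group_def)
  qed
  moreover have "bij_betw ?h (carrier (alt_group 24)) Z"
  proof (rule bij_betw_byWitness[where f' = "map_permutation orbit (inv_into {1..24} f)"])
    let ?g = "inv_into {1..24} f"
    have g: "bij_betw ?g orbit {1..24}" by (rule bij_betw_inv_into[OF f])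
    show "\<forall>p\<in>carrier (alt_group 24). map_permutation orbit ?g (?h p) = p"
      using map_permutation_compose_inv[OF f] bij_betw_inv_into_left[OF f]
      by (metis alt_group_carrier)
    show "\<forall>z\<in>Z. ?h (map_permutation orbit ?g z) = z"
      using map_permutation_compose_inv[OF g] bij_betw_inv_into_right[OF f]
      by (metis Z_iff)
    show "?h ` carrier (alt_group 24) \<subseteq> Z"
      using map_permutation_alt_in_Z[OF f] by blast
    \<comment> \<open>Surjectivity rests on this inclusion: by \<open>Z_even\<close>, transporting
      an element of \<open>Z\<close> back to the numbers yields an even permutation.\<close>
    have "map_permutation orbit ?g z \<in> carrier (alt_group 24)" if "z \<in> Z" for z
      using that Z_even[OF that] map_permutation_permutes[OF g]
        evenperm_map_permutation[OF bij_betw_imp_inj_on[OF g] _ finite_center_corner_orbit]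
      by (auto simp: alt_group_carrier Z_iff)
    then show "map_permutation orbit ?g ` Z \<subseteq> carrier (alt_group 24)"
      by blast
  qed
  ultimately have "alt_group 24 \<cong> (rubik_group n)\<lparr>carrier := Z\<rparr>"
    by (auto simp: is_iso_def iso_def)
  then show ?thesis
    by (rule group.iso_sym[OF alt_group_is_group])
qed

end

theorem theorem12:
  fixes n i :: nat
  assumes "n \<ge> 4" and "2 \<le> i" and "i \<le> n div 2"
  shows "(rubik_group n) \<lparr> carrier := Z_center_corner n i \<rparr> \<cong> alt_group 24"
proof -
  interpret center_corner n i "n + 1 - i"
    using assms by unfold_locales auto
  show ?thesis by (rule Z_iso_alt_group)
qed

end
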